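(* For $n \geq 3$, $t \in (\frac{1}{\sqrt{2}},1]$ and every unit vector $a$ in $\mathbb{R}^n$, we have $$\left|B_1^n \cap \{x \in \mathbb{R}^n : |\langle x, a\rangle| \leq t\}\right| \geq \frac{2^n}{n!}\left(1 - (1-t)^n\right)$$ with equality if and only if the direction of $a$ is along one of the (coordinate) axes.
   Context: $B_1^n = \{x \in \mathbb{R}^n : \sum_{i=1}^n |x_i| \leq 1\}$ is the cross-polytope, $\langle x,y\rangle = \sum_{i=1}^n x_i y_i$ is the standard scalar product on $\mathbb{R}^n$, a unit vector is one of Euclidean length $1$, and $|\cdot|$ of a subset of $\mathbb{R}^n$ is its $n$-dimensional Lebesgue measure.
   Formalization: The equality condition is corrected to "a is along a coordinate axis or t = 1", because at t = 1 the slab contains all of the cross-polytope and equality holds for every unit vector a; for t < 1 the equivalence is as stated. *)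

theory Defs
  imports "HOL-Analysis.Analysis"
begin

definition cross_polytope :: "(real ^ 'n) set" where
  "cross_polytope = {x. (\<Sum>i\<in>UNIV. \<bar>x $ i\<bar>) \<le> 1}"

definition symmetric_slab :: "real ^ 'n \<Rightarrow> real \<Rightarrow> (real ^ 'n) set" where
  "symmetric_slab a t = {x. \<bar>x \<bullet> a\<bar> \<le> t}"

definition along_coordinate_axis :: "real ^ 'n \<Rightarrow> bool" where
  "along_coordinate_axis a \<longleftrightarrow> (\<exists>i c. a = c *\<^sub>R axis i 1)"

end

theory Submission
  imports Defs
begin

text \<open>
  Write \<open>n\<close> for the dimension. The slab cuts two opposite caps off the cross-polytope, and the whole
  cross-polytope has volume \<open>2^n / n!\<close>, so the assertion is an upper bound for the volume of one cap.
  Since \<open>t > 1 / sqrt 2\<close> and \<open>a\<close> is a unit vector, at most one coordinate of \<open>a\<close> can exceed \<open>t\<close> in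
  absolute value. If there is none, all vertices lie in the slab and nothing is cut off. Otherwise let
  this coordinate be \<open>a $ k = u > t\<close>, after a reflection. The cap then contains a single vertex, the
  \<open>k\<close>-th unit vector, so near it the cap is a piece cut by one hyperplane from the cone of the polytope
  at that vertex, and its volume can be computed exactly (lemma \<open>measure_cross_polytope_cap\<close>):
  \<open>(u - t)^n / (n! u)\<close> times the product of \<open>2 u / (u^2 - a_j^2)\<close> over \<open>j \<noteq> k\<close>.

  For the computation, shear along the \<open>k\<close>-th axis so that the cutting hyperplane becomes the
  hyperplane \<open>x_k = 0\<close>. A shear preserves volume by Fubini and translation invariance on the lines
  parallel to the axis (lemma \<open>distr_lborel_shear\<close>). The image of the cap is a polytope whose part in
  each orthant is a simplex with its legs on the axes, and adding up these simplices gives a product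
  (lemma \<open>measure_skew_cross_polytope\<close>), which also covers the cross-polytope itself.

  For the estimate, the squares \<open>a_j^2\<close> with \<open>j \<noteq> k\<close> add up to \<open>1 - u^2\<close>, so the Weierstrass product
  inequality bounds the product of all \<open>u^2 - a_j^2\<close> from below by \<open>u^(2n-4) (2 u^2 - 1)\<close>. What is
  left is an inequality in \<open>t\<close> and \<open>u\<close> alone (lemma \<open>power_cap_bound\<close>). It is strict for \<open>u < 1\<close>,
  while \<open>u = 1\<close> means that \<open>a\<close> is a coordinate vector and all the estimates are equalities.
\<close>

section \<open>Shears preserve Lebesgue measure\<close>

lemma nn_integral_lborel_split_coordinate:
  fixes b :: "'a::euclidean_space" and f :: "'a \<Rightarrow> ennreal"
  assumes b: "b \<in> Basis" and f [measurable]: "f \<in> borel_measurable borel"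
  shows "(\<integral>\<^sup>+x. f x \<partial>lborel) =
    (\<integral>\<^sup>+x. (\<integral>\<^sup>+y. f ((\<Sum>i\<in>Basis - {b}. x i *\<^sub>R i) + y *\<^sub>R b) \<partial>lborel)
       \<partial>(\<Pi>\<^sub>M i\<in>Basis - {b}. lborel))"
proof -
  interpret product_sigma_finite "\<lambda>_::'a. lborel :: real measure"
    by standard
  let ?A = "Basis - {b}"
  have B: "insert b ?A = Basis"
    using b by blast
  have "(\<integral>\<^sup>+x. f x \<partial>lborel) = (\<integral>\<^sup>+x. f (\<Sum>i\<in>Basis. x i *\<^sub>R i) \<partial>(\<Pi>\<^sub>M i\<in>Basis. lborel))"
    by (subst lborel_eq) (simp add: nn_integral_distr)
  also have "\<dots> = (\<integral>\<^sup>+x. (\<integral>\<^sup>+y. f (\<Sum>i\<in>Basis. (x(b := y)) i *\<^sub>R i) \<partial>lborel)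
       \<partial>(\<Pi>\<^sub>M i\<in>?A. lborel))"
    using product_nn_integral_insert[of ?A b "\<lambda>x. f (\<Sum>i\<in>Basis. x i *\<^sub>R i)"] unfolding B
    by simp
  also have "(\<lambda>x y. \<Sum>i\<in>Basis. (x(b := y)) i *\<^sub>R i) = (\<lambda>x y. (\<Sum>i\<in>?A. x i *\<^sub>R i) + y *\<^sub>R b)"
  proof (intro ext)
    fix x :: "'a \<Rightarrow> real" and y :: real
    have "(\<Sum>i\<in>?A. (x(b := y)) i *\<^sub>R i) = (\<Sum>i\<in>?A. x i *\<^sub>R i)"
      by (rule sum.cong) auto
    then show "(\<Sum>i\<in>Basis. (x(b := y)) i *\<^sub>R i) = (\<Sum>i\<in>?A. x i *\<^sub>R i) + y *\<^sub>R b"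
      by (simp add: sum.remove[OF _ b] add.commute)
  qed
  finally show ?thesis
    by (simp add: fun_eq_iff)
qed

text \<open>
  On each line parallel to \<open>b\<close> the function \<open>g\<close> is constant, so the map translates that line and
  preserves its length measure; integrating over all such lines gives the claim.
\<close>

lemma distr_lborel_shear:
  fixes b :: "'a::euclidean_space" and g :: "'a \<Rightarrow> real"
  assumes b: "b \<in> Basis" and g [measurable]: "g \<in> borel_measurable borel"
    and inv: "\<And>x c. g (x + c *\<^sub>R b) = g x"
  shows "distr lborel borel (\<lambda>x. x + g x *\<^sub>R b) = lborel"
proof (rule measure_eqI)
  fix A :: "'a set"
  assume "A \<in> sets (distr lborel borel (\<lambda>x. x + g x *\<^sub>R b))"
  then have A [measurable]: "A \<in> sets borel"
    by simp
  let ?P = "\<Pi>\<^sub>M i\<in>Basis - {b}. (lborel :: real measure)"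
  let ?v = "\<lambda>x :: 'a \<Rightarrow> real. \<Sum>i\<in>Basis - {b}. x i *\<^sub>R i"
  have translate: "(\<integral>\<^sup>+y. indicator A (v + (y + c) *\<^sub>R b) \<partial>lborel)
      = (\<integral>\<^sup>+y. indicator A (v + y *\<^sub>R b) \<partial>lborel)" for v and c :: real
    using nn_integral_real_affine[of "\<lambda>y. indicator A (v + y *\<^sub>R b)" 1 c]
    by (simp add: add.commute)
  have "emeasure (distr lborel borel (\<lambda>x. x + g x *\<^sub>R b)) A
      = (\<integral>\<^sup>+x. indicator A (x + g x *\<^sub>R b) \<partial>lborel)"
    by (simp add: nn_integral_distr flip: nn_integral_indicator)
  also have "\<dots> = (\<integral>\<^sup>+x. (\<integral>\<^sup>+y. indicator A (?v x + (y + g (?v x)) *\<^sub>R b) \<partial>lborel) \<partial>?P)"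
    by (subst nn_integral_lborel_split_coordinate[OF b]) (simp_all add: inv scaleR_add_left add.assoc)
  also have "\<dots> = (\<integral>\<^sup>+x. indicator A x \<partial>lborel)"
    unfolding translate by (rule nn_integral_lborel_split_coordinate[OF b, symmetric]) simp
  finally show "emeasure (distr lborel borel (\<lambda>x. x + g x *\<^sub>R b)) A = emeasure lborel A"
    by simp
qed simp

section \<open>Polytopes with vertices on the coordinate axes\<close>

definition corner_simplex :: "(real ^ 'n) set" where
  "corner_simplex = {x. (\<forall>i. 0 \<le> x $ i) \<and> (\<Sum>i\<in>UNIV. x $ i) \<le> 1}"

lemma corner_simplex_eq: "(corner_simplex :: (real ^ 'n) set) = convex hull (insert 0 Basis)"
proof -
  have "sum (\<lambda>b. x \<bullet> b) Basis = (\<Sum>i\<in>UNIV. x $ i)" for x :: "real ^ 'n"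
  proof -
    have B: "Basis = range (\<lambda>i::'n. axis i (1::real))"
      by (auto simp: Basis_vec_def)
    show ?thesis unfolding B
      by (subst sum.reindex) (auto simp: inj_on_def axis_eq_axis inner_axis)
  qed
  then show ?thesis
    unfolding corner_simplex_def std_simplex by (auto simp: Basis_vec_def inner_axis)
qed

lemma compact_corner_simplex: "compact (corner_simplex :: (real ^ 'n) set)"
  unfolding corner_simplex_eq by (simp add: finite_imp_compact_convex_hull)

lemma measure_corner_simplex: "measure lebesgue (corner_simplex :: (real ^ 'n) set) = 1 / fact CARD('n)"
proof -
  have "(corner_simplex :: (real ^ 'n) set) \<in> sets lborel"
    by (simp add: compact_corner_simplex borel_compact)
  then show ?thesis
    using content_std_simplex[where 'a = "real ^ 'n"]
    by (simp add: measure_completion corner_simplex_eq)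
qed

text \<open>
  The convex hull of the points \<open>p j\<close> and \<open>- q j\<close> on the \<open>j\<close>-th axis, written by means of its gauge. The
  case \<open>q j = 0\<close> is allowed: the polytope then lies on one side of the hyperplane \<open>x $ j = 0\<close>. This is
  how a cap appears after the shear.
\<close>

definition skew_cross_polytope :: "('n \<Rightarrow> real) \<Rightarrow> ('n \<Rightarrow> real) \<Rightarrow> (real ^ 'n) set" where
  "skew_cross_polytope p q = {x. (\<forall>j. q j = 0 \<longrightarrow> 0 \<le> x $ j) \<and>
     (\<Sum>j\<in>UNIV. if 0 \<le> x $ j then x $ j / p j else - x $ j / q j) \<le> 1}"

text \<open>
  A choice of one vertex \<open>e j\<close> on each axis spans one simplex with the origin, and stretching the
  coordinates of the standard simplex by \<open>e\<close> produces it.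
\<close>

lemma skew_cross_polytope_eq_Union:
  fixes p q :: "'n::finite \<Rightarrow> real"
  assumes p: "\<And>j. 0 < p j" and q: "\<And>j. 0 \<le> q j"
  shows "skew_cross_polytope p q =
    (\<Union>e\<in>(\<Pi>\<^sub>E j\<in>UNIV. {p j, - q j}). (\<lambda>x. \<chi> j. e j * x $ j) ` corner_simplex)" (is "_ = ?U")
proof (intro equalityI subsetI)
  fix x assume x: "x \<in> skew_cross_polytope p q"
  define e where "e j = (if 0 \<le> x $ j then p j else - q j)" for j
  define y where "y = (\<chi> j. if 0 \<le> x $ j then x $ j / p j else - x $ j / q j)"
  have "e \<in> (\<Pi>\<^sub>E j\<in>UNIV. {p j, - q j})"
    by (auto simp: e_def)
  moreover have "y \<in> corner_simplex"
    using x p q by (auto simp: corner_simplex_def y_def skew_cross_polytope_def less_imp_le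
        intro: divide_nonpos_nonneg)
  moreover have "x = (\<chi> j. e j * y $ j)"
    using x p unfolding skew_cross_polytope_def
    by (auto simp: vec_eq_iff e_def y_def less_imp_neq[symmetric])
  ultimately show "x \<in> ?U" by blast
next
  fix x assume "x \<in> ?U"
  then obtain e y where e: "\<And>j. e j \<in> {p j, - q j}" and y: "y \<in> corner_simplex"
    and x: "x = (\<chi> j. e j * y $ j)"
    by (auto simp: PiE_iff)
  have y0: "0 \<le> y $ j" for j
    using y by (simp add: corner_simplex_def)
  have le: "(if 0 \<le> x $ j then x $ j / p j else - x $ j / q j) \<le> y $ j"
     and nn: "q j = 0 \<longrightarrow> 0 \<le> x $ j" for j
    using e[of j] p[of j] q[of j] y0[of j]
    by (auto simp: x zero_le_mult_iff mult_nonneg_nonpos split: if_splits)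
  have "(\<Sum>j\<in>UNIV. if 0 \<le> x $ j then x $ j / p j else - x $ j / q j) \<le> (\<Sum>j\<in>UNIV. y $ j)"
    by (intro sum_mono le)
  then show "x \<in> skew_cross_polytope p q"
    using y nn by (simp add: skew_cross_polytope_def corner_simplex_def)
qed

text \<open>
  Two different choices of vertices give simplices that meet only inside a coordinate hyperplane.
  The volume is therefore the sum over all choices \<open>e\<close> of the product of the numbers \<open>\<bar>e j\<bar>\<close>, divided by
  the factorial, and this sum of products factors as a product of sums.
\<close>

lemma
  fixes p q :: "'n::finite \<Rightarrow> real"
  assumes p: "\<And>j. 0 < p j" and q: "\<And>j. 0 \<le> q j"
  shows measure_skew_cross_polytope:
      "measure lebesgue (skew_cross_polytope p q) = (\<Prod>j\<in>UNIV. p j + q j) / fact CARD('n)"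
    and compact_skew_cross_polytope: "compact (skew_cross_polytope p q)"
proof -
  let ?E = "\<Pi>\<^sub>E j\<in>UNIV. {p j, - q j}"
  let ?f = "\<lambda>e (x :: real ^ 'n). \<chi> j. e j * x $ j"
  have lm: "(corner_simplex :: (real ^ 'n) set) \<in> lmeasurable"
    by (simp add: compact_corner_simplex lmeasurable_compact)
  have fin: "finite ?E"
    by (intro finite_PiE) auto
  have "compact (?f e ` corner_simplex)" for e
    by (intro compact_continuous_image compact_corner_simplex continuous_intros)
  with fin show "compact (skew_cross_polytope p q)"
    unfolding skew_cross_polytope_eq_Union[OF assms] by (intro compact_UN) auto
  have "negligible (?f d ` corner_simplex \<inter> ?f e ` corner_simplex)"
    if de: "d \<in> ?E" "e \<in> ?E" "d \<noteq> e" for d e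
  proof -
    obtain j where j: "d j \<noteq> e j" using de by blast
    have de': "d j \<in> {p j, - q j}" "e j \<in> {p j, - q j}"
      using de by (auto simp: PiE_iff)
    have "?f d ` corner_simplex \<inter> ?f e ` corner_simplex \<subseteq> {x. x $ j = 0}"
    proof clarify
      fix x y assume *: "x \<in> corner_simplex" "y \<in> corner_simplex" "?f d x = ?f e y"
      then have eq: "d j * x $ j = e j * y $ j" and nn: "0 \<le> x $ j" "0 \<le> y $ j"
        by (auto simp: vec_eq_iff corner_simplex_def)
      have "0 \<le> p j * u" "0 \<le> q j * u" if "0 \<le> u" for u
        using p[of j] q[of j] that by auto
      with nn eq de' j have "d j * x $ j = 0"
        by (smt (verit) insertE mult_minus_left singletonD)
      then show "?f d x $ j = 0" by simp
    qed
    then show ?thesis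
      by (rule negligible_subset[OF negligible_standard_hyperplane_cart])
  qed
  then have "measure lebesgue (skew_cross_polytope p q)
      = (\<Sum>e\<in>?E. measure lebesgue (?f e ` corner_simplex))"
    unfolding skew_cross_polytope_eq_Union[OF assms]
    by (intro measure_negligible_finite_Union_image fin measurable_stretch lm)
       (auto simp: pairwise_def)
  also have "\<dots> = (\<Sum>e\<in>?E. \<Prod>j\<in>UNIV. \<bar>e j\<bar>) / fact CARD('n)"
    by (simp add: measure_stretch[OF lm] measure_corner_simplex abs_prod sum_divide_distrib)
  also have "(\<Sum>e\<in>?E. \<Prod>j\<in>UNIV. \<bar>e j\<bar>) = (\<Prod>j\<in>UNIV. \<Sum>e\<in>{p j, - q j}. \<bar>e\<bar>)"
    by (rule prod_sum_PiE[symmetric]) auto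
  also have "\<dots> = (\<Prod>j\<in>UNIV. p j + q j)"
  proof (rule prod.cong)
    fix j
    show "(\<Sum>e\<in>{p j, - q j}. \<bar>e\<bar>) = p j + q j"
      using p[of j] q[of j] by (subst sum.insert) auto
  qed simp
  finally show "measure lebesgue (skew_cross_polytope p q) = (\<Prod>j\<in>UNIV. p j + q j) / fact CARD('n)" .
qed

lemma
  shows measure_cross_polytope:
      "measure lebesgue (cross_polytope :: (real ^ 'n) set) = 2 ^ CARD('n) / fact CARD('n)"
    and compact_cross_polytope: "compact (cross_polytope :: (real ^ 'n) set)"
proof -
  have "(cross_polytope :: (real ^ 'n) set) = skew_cross_polytope (\<lambda>_. 1) (\<lambda>_. 1)"
    by (simp add: cross_polytope_def skew_cross_polytope_def abs_if not_less if_distrib cong: if_cong)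
       (smt (verit, best) Collect_cong sum.cong)
  note eq = this
  show "measure lebesgue (cross_polytope :: (real ^ 'n) set) = 2 ^ CARD('n) / fact CARD('n)"
    unfolding eq by (subst measure_skew_cross_polytope) auto
  show "compact (cross_polytope :: (real ^ 'n) set)"
    unfolding eq by (rule compact_skew_cross_polytope) auto
qed

section \<open>Elementary inequalities\<close>

text \<open>
  The Weierstrass product inequality, used to bound the denominators in the volume of a cap.
\<close>

lemma prod_one_minus_ge:
  fixes x :: "'a \<Rightarrow> real"
  assumes "finite A" "\<And>i. i \<in> A \<Longrightarrow> 0 \<le> x i" "(\<Sum>i\<in>A. x i) \<le> 1"
  shows "1 - (\<Sum>i\<in>A. x i) \<le> (\<Prod>i\<in>A. 1 - x i)"
  using assms
proof (induction rule: finite_induct)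
  case (insert i A)
  have "1 - (x i + sum x A) \<le> (1 - x i) * (1 - sum x A)"
    using insert by (simp add: algebra_simps sum_nonneg)
  also have "\<dots> \<le> (1 - x i) * (\<Prod>i\<in>A. 1 - x i)"
  proof (rule mult_left_mono)
    have "0 \<le> x i" "0 \<le> sum x A" "x i + sum x A \<le> 1"
      using insert by (auto simp: sum_nonneg)
    moreover have "1 - sum x A \<le> (\<Prod>i\<in>A. 1 - x i)" if "sum x A \<le> 1"
      using insert.IH insert.prems(1) that by simp
    ultimately show "1 - sum x A \<le> (\<Prod>i\<in>A. 1 - x i)" "0 \<le> 1 - x i"
      by linarith+
  qed
  finally show ?case using insert by simp
qed simp

text \<open>
  Here lies the reason for the threshold \<open>1 / sqrt 2\<close>. With \<open>q = 1 - t\<close> and \<open>d = 1 - u\<close> the difference of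
  the two sides is \<open>d\<close> times an expression that is affine and decreasing in \<open>d\<close>. At the end \<open>d = q\<close>,
  that is \<open>u = t\<close>, this expression equals \<open>q (2 t^2 - 1)\<close>.
\<close>

lemma quadratic_cap_bound:
  fixes t u :: real
  assumes t: "1 < 2 * t\<^sup>2" "0 < t" and u: "t < u" "u < 1"
  shows "(u - t)\<^sup>2 < (1 - t)\<^sup>2 * (2 * u\<^sup>2 - 1)"
proof -
  define q d where "q = 1 - t" and "d = 1 - u"
  have qd: "0 < d" "d < q" "q < 1" using assms by (auto simp: q_def d_def)
  have t2: "0 < 1 - 4 * q + 2 * q\<^sup>2" using t by (simp add: q_def power2_eq_square algebra_simps)
  have "q * (1 - q) > 0" using qd by simp
  then have q2: "q\<^sup>2 < q" by (simp add: power2_eq_square algebra_simps)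
  then have "0 < 1 - 2 * q\<^sup>2" using t2 qd
    by (smt (verit))
  then have "d * (1 - 2 * q\<^sup>2) \<le> q * (1 - 2 * q\<^sup>2)"
    using qd by simp
  moreover have "0 < q * (1 - 4 * q + 2 * q\<^sup>2)" using qd t2 by simp
  ultimately have "0 < 2 * q - 4 * q\<^sup>2 - d * (1 - 2 * q\<^sup>2)"
    by (simp add: algebra_simps power2_eq_square)
  then have "0 < d * (2 * q - 4 * q\<^sup>2 - d * (1 - 2 * q\<^sup>2))" using qd by simp
  also have "\<dots> = (1 - t)\<^sup>2 * (2 * u\<^sup>2 - 1) - (u - t)\<^sup>2"
    by (simp add: q_def d_def) algebra
  finally show ?thesis by simp
qed

text \<open>
  Two of the factors \<open>u - t\<close> are handled by the quadratic bound, each of the others by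
  \<open>u - t \<le> (1 - t) u\<close>.
\<close>

lemma power_cap_bound:
  fixes t u :: real
  assumes t: "1 < 2 * t\<^sup>2" "0 < t" and u: "t < u" "u < 1" and n: "2 \<le> n"
  shows "(u - t) ^ n < (1 - t) ^ n * (u ^ (n - 2) * (2 * u\<^sup>2 - 1))"
proof -
  obtain m where m: "n = m + 2" using n by (metis add.commute le_Suc_ex)
  have "t * u < t" using t u by simp
  then have "u - t \<le> (1 - t) * u" by (simp add: algebra_simps)
  then have "(u - t) ^ m \<le> ((1 - t) * u) ^ m" using u by (intro power_mono) auto
  moreover have "0 < (u - t) ^ m" using u by simp
  ultimately have "(u - t) ^ m * (u - t)\<^sup>2 < ((1 - t) * u) ^ m * ((1 - t)\<^sup>2 * (2 * u\<^sup>2 - 1))"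
    by (intro mult_le_less_imp_less quadratic_cap_bound assms) auto
  then show ?thesis
    by (simp add: m power_add power_mult_distrib power2_eq_square mult_ac)
qed

section \<open>The volume of a cap with a single vertex\<close>

text \<open>
  The map replaces \<open>x $ k\<close> by \<open>(x \<bullet> a - t) / a $ k\<close>, hence takes the cutting hyperplane to \<open>x $ k = 0\<close>.
  In the new coordinates the condition \<open>\<bar>x\<bar>\<^sub>1 \<le> 1\<close> becomes
  \<open>a $ k * x $ k + (\<Sum>j \<noteq> k. a $ k * \<bar>x $ j\<bar> - a $ j * x $ j) \<le> a $ k - t\<close>, where each summand is linear on
  either half of its axis; this is the gauge of a skew cross-polytope.
\<close>

lemma cap_eq_vimage_skew_cross_polytope:
  fixes a :: "real ^ 'n" and t :: real
  assumes t: "0 \<le> t" and k: "t < a $ k" and small: "\<And>j. j \<noteq> k \<Longrightarrow> \<bar>a $ j\<bar> \<le> t"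
  defines "s \<equiv> a $ k - t"
  shows "cross_polytope \<inter> {x. t \<le> x \<bullet> a} =
    (\<lambda>x. x + ((x \<bullet> a - t) / a $ k - x $ k) *\<^sub>R axis k 1) -`
      skew_cross_polytope (\<lambda>j. if j = k then s / a $ k else s / (a $ k - a $ j))
        (\<lambda>j. if j = k then 0 else s / (a $ k + a $ j))"
    (is "_ = ?T -` skew_cross_polytope ?p ?q")
proof (rule set_eqI)
  fix x :: "real ^ 'n"
  let ?A = "UNIV - {k}"
  have s: "0 < s" and ak: "0 < a $ k"
    using t k by (auto simp: s_def)
  have small': "0 < a $ k - a $ j" "0 < a $ k + a $ j" if "j \<noteq> k" for j
    using small[OF that] k by auto
  have Tk: "?T x $ k = (x \<bullet> a - t) / a $ k" and Tj: "\<And>j. j \<noteq> k \<Longrightarrow> ?T x $ j = x $ j"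
    by (auto simp: axis_def)
  have inner: "x \<bullet> a = a $ k * x $ k + (\<Sum>j\<in>?A. a $ j * x $ j)"
    by (simp add: inner_vec_def sum.remove[of UNIV k] mult.commute)
  have norm1: "(\<Sum>j\<in>UNIV. \<bar>x $ j\<bar>) = \<bar>x $ k\<bar> + (\<Sum>j\<in>?A. \<bar>x $ j\<bar>)"
    by (simp add: sum.remove[of UNIV k])
  (* All other vertices satisfy the reverse inequality, so the half-space meets the cone at the
     k-th vertex only where x $ k is nonnegative; there the cone and the polytope agree. *)
  have nonneg: "0 \<le> x $ k" if "x $ k + (\<Sum>j\<in>?A. \<bar>x $ j\<bar>) \<le> 1" "t \<le> x \<bullet> a"
  proof (rule ccontr)
    assume neg: "\<not> 0 \<le> x $ k"
    have "(\<Sum>j\<in>?A. a $ j * x $ j) \<le> (\<Sum>j\<in>?A. t * \<bar>x $ j\<bar>)"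
    proof (rule sum_mono)
      fix j assume "j \<in> ?A"
      then have "\<bar>a $ j\<bar> * \<bar>x $ j\<bar> \<le> t * \<bar>x $ j\<bar>"
        by (intro mult_right_mono small) auto
      then show "a $ j * x $ j \<le> t * \<bar>x $ j\<bar>"
        by (metis abs_ge_self abs_mult order_trans)
    qed
    also have "\<dots> \<le> t * (1 - x $ k)"
      using that(1) t unfolding sum_distrib_left[symmetric] by (intro mult_left_mono) auto
    finally have "t \<le> a $ k * x $ k + t * (1 - x $ k)"
      using that(2) inner by simp
    moreover have "(a $ k - t) * x $ k < 0"
      using neg k t by (intro mult_pos_neg) auto
    ultimately show False by (simp add: algebra_simps)
  qed
  have "x \<in> ?T -` skew_cross_polytope ?p ?q \<longleftrightarrow> 0 \<le> ?T x $ k \<and>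
      (\<Sum>j\<in>UNIV. if 0 \<le> ?T x $ j then ?T x $ j / ?p j else - ?T x $ j / ?q j) \<le> 1"
  proof -
    have "?q j = 0 \<longleftrightarrow> j = k" for j
      using s small'[of j] by auto
    then show ?thesis
      unfolding skew_cross_polytope_def vimage_Collect_eq mem_Collect_eq by auto
  qed
  also have "\<dots> \<longleftrightarrow> 0 \<le> ?T x $ k \<and> ?T x $ k / ?p k +
      (\<Sum>j\<in>?A. if 0 \<le> ?T x $ j then ?T x $ j / ?p j else - ?T x $ j / ?q j) \<le> 1"
    by (subst sum.remove[of UNIV k]) auto
  also have "(\<Sum>j\<in>?A. if 0 \<le> ?T x $ j then ?T x $ j / ?p j else - ?T x $ j / ?q j)
      = (\<Sum>j\<in>?A. (a $ k * \<bar>x $ j\<bar> - a $ j * x $ j) / s)"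
    using Tj by (intro sum.cong) (auto simp: abs_if algebra_simps)
  also have "\<dots> = (a $ k * (\<Sum>j\<in>?A. \<bar>x $ j\<bar>) - (\<Sum>j\<in>?A. a $ j * x $ j)) / s"
    by (simp add: sum_subtractf sum_distrib_left flip: sum_divide_distrib)
  also have "?T x $ k / ?p k = (x \<bullet> a - t) / s"
    using ak by (simp add: Tk)
  also have "(x \<bullet> a - t) / s + (a $ k * (\<Sum>j\<in>?A. \<bar>x $ j\<bar>) - (\<Sum>j\<in>?A. a $ j * x $ j)) / s
      = (a $ k * (x $ k + (\<Sum>j\<in>?A. \<bar>x $ j\<bar>)) - t) / s"
    by (simp add: inner algebra_simps flip: add_divide_distrib)
  also have "\<dots> \<le> 1 \<longleftrightarrow> a $ k * (x $ k + (\<Sum>j\<in>?A. \<bar>x $ j\<bar>)) \<le> a $ k * 1"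
    using s by (simp add: s_def)
  also have "\<dots> \<longleftrightarrow> x $ k + (\<Sum>j\<in>?A. \<bar>x $ j\<bar>) \<le> 1"
    using ak by (subst mult_le_cancel_left_pos) auto
  also have "0 \<le> ?T x $ k \<longleftrightarrow> t \<le> x \<bullet> a"
    using ak by (simp only: Tk zero_le_divide_iff) auto
  finally have T: "x \<in> ?T -` skew_cross_polytope ?p ?q \<longleftrightarrow>
      t \<le> x \<bullet> a \<and> x $ k + (\<Sum>j\<in>?A. \<bar>x $ j\<bar>) \<le> 1" .
  show "x \<in> cross_polytope \<inter> {x. t \<le> x \<bullet> a} \<longleftrightarrow> x \<in> ?T -` skew_cross_polytope ?p ?q"
  proof
    assume "x \<in> cross_polytope \<inter> {x. t \<le> x \<bullet> a}"
    then show "x \<in> ?T -` skew_cross_polytope ?p ?q"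
      unfolding T using norm1 by (auto simp: cross_polytope_def)
  next
    assume "x \<in> ?T -` skew_cross_polytope ?p ?q"
    then have x: "t \<le> x \<bullet> a" and le: "x $ k + (\<Sum>j\<in>?A. \<bar>x $ j\<bar>) \<le> 1"
      unfolding T by auto
    have "0 \<le> x $ k"
      using nonneg x le by blast
    then show "x \<in> cross_polytope \<inter> {x. t \<le> x \<bullet> a}"
      using x le norm1 by (simp add: cross_polytope_def)
  qed
qed

lemma measure_cross_polytope_cap:
  fixes a :: "real ^ 'n" and t :: real
  assumes t: "0 \<le> t" and k: "t < a $ k" and small: "\<And>j. j \<noteq> k \<Longrightarrow> \<bar>a $ j\<bar> \<le> t"
  shows "measure lebesgue (cross_polytope \<inter> {x. t \<le> x \<bullet> a}) =
    (a $ k - t) ^ CARD('n) / (fact CARD('n) * a $ k)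
      * (\<Prod>j\<in>UNIV - {k}. 2 * a $ k / ((a $ k)\<^sup>2 - (a $ j)\<^sup>2))"
proof -
  define s where "s = a $ k - t"
  define p where "p j = (if j = k then s / a $ k else s / (a $ k - a $ j))" for j
  define q where "q j = (if j = k then 0 else s / (a $ k + a $ j))" for j
  define g where "g x = (x \<bullet> a - t) / a $ k - x $ k" for x :: "real ^ 'n"
  have s: "0 < s" and ak: "0 < a $ k"
    using t k by (auto simp: s_def)
  have small': "0 < a $ k - a $ j" "0 < a $ k + a $ j" if "j \<noteq> k" for j
    using small[OF that] k by auto
  have p: "0 < p j" and q: "0 \<le> q j" for j
    using s ak small'[of j] by (auto simp: p_def q_def)
  let ?cap = "cross_polytope \<inter> {x. t \<le> x \<bullet> a}"
  let ?W = "skew_cross_polytope p q" and ?T = "\<lambda>x. x + g x *\<^sub>R axis k 1"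
  have g [measurable]: "g \<in> borel_measurable borel"
    unfolding g_def[abs_def]
    by (intro borel_measurable_continuous_onI continuous_intros) (use ak in auto)
  have W [measurable]: "?W \<in> sets borel"
    by (intro borel_compact compact_skew_cross_polytope p q)
  have cap: "?cap = ?T -` ?W"
    using cap_eq_vimage_skew_cross_polytope[OF assms]
    unfolding g_def p_def q_def s_def .
  have distr: "distr lborel borel ?T = lborel"
  proof (rule distr_lborel_shear[OF _ g])
    show "axis k 1 \<in> (Basis :: (real ^ 'n) set)"
      by (simp add: axis_in_Basis_iff)
    show "g (x + c *\<^sub>R axis k 1) = g x" for x c
      using ak by (simp add: g_def inner_add_left inner_axis' field_simps)
  qed
  have T [measurable]: "?T \<in> borel_measurable borel"
    by measurable
  have "?cap \<in> sets lborel"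
    unfolding cap using measurable_sets[OF T W] by simp
  then have "measure lebesgue ?cap = measure lborel (?T -` ?W)"
    by (simp add: measure_completion cap)
  also have "\<dots> = measure lborel ?W"
    using measure_distr[of ?T lborel borel ?W] by (simp add: distr)
  also have "\<dots> = (\<Prod>j\<in>UNIV. p j + q j) / fact CARD('n)"
    using measure_skew_cross_polytope[of p q, OF p q] by (simp add: measure_completion)
  also have "(\<Prod>j\<in>UNIV. p j + q j) = s / a $ k * (\<Prod>j\<in>UNIV - {k}. p j + q j)"
    by (subst prod.remove[of UNIV k]) (auto simp: p_def q_def)
  also have "(\<Prod>j\<in>UNIV - {k}. p j + q j)
      = (\<Prod>j\<in>UNIV - {k}. s * (2 * a $ k / ((a $ k)\<^sup>2 - (a $ j)\<^sup>2)))"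
  proof (rule prod.cong)
    fix j assume "j \<in> UNIV - {k}"
    then have j: "j \<noteq> k" by simp
    have "(a $ k)\<^sup>2 - (a $ j)\<^sup>2 = (a $ k - a $ j) * (a $ k + a $ j)"
      by (simp add: power2_eq_square algebra_simps)
    then show "p j + q j = s * (2 * a $ k / ((a $ k)\<^sup>2 - (a $ j)\<^sup>2))"
      using small'[OF j] j by (simp add: p_def q_def field_simps)
  qed simp
  also have "\<dots> = s ^ (CARD('n) - 1) * (\<Prod>j\<in>UNIV - {k}. 2 * a $ k / ((a $ k)\<^sup>2 - (a $ j)\<^sup>2))"
    unfolding prod.distrib by simp
  finally have "measure lebesgue ?cap = s * s ^ (CARD('n) - 1) / (fact CARD('n) * a $ k)
      * (\<Prod>j\<in>UNIV - {k}. 2 * a $ k / ((a $ k)\<^sup>2 - (a $ j)\<^sup>2))"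
    by (simp add: mult_ac)
  also have "s * s ^ (CARD('n) - 1) = s ^ CARD('n)"
    by (simp flip: power_Suc)
  finally show ?thesis
    by (simp add: s_def)
qed

section \<open>The cap of a unit vector\<close>

lemma one_less_twice_square:
  fixes t :: real
  assumes "1 / sqrt 2 < t"
  shows "0 < t" "1 < 2 * t\<^sup>2"
proof -
  have "0 < 1 / sqrt (2 :: real)" by simp
  with assms show "0 < t" by (rule less_trans[rotated])
  have "(1 / sqrt 2)\<^sup>2 < t\<^sup>2"
    using assms by (intro power_strict_mono) auto
  then show "1 < 2 * t\<^sup>2"
    by (simp add: power_divide)
qed

lemma unit_vector_square_sum:
  fixes a :: "real ^ 'n"
  assumes "norm a = 1"
  shows "(\<Sum>j\<in>UNIV - {k}. (a $ j)\<^sup>2) = 1 - (a $ k)\<^sup>2"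
proof -
  have "(\<Sum>j\<in>UNIV. (a $ j)\<^sup>2) = 1"
    using assms by (simp add: norm_eq_1 inner_vec_def power2_eq_square)
  then show ?thesis
    by (simp add: sum.remove[of UNIV k])
qed

text \<open>
  The number \<open>V\<close> is the volume of the cap cut off orthogonally to an axis. For \<open>a $ k < 1\<close> the exact
  formula is compared with it: replacing the denominators by their Weierstrass lower bound leaves
  precisely the inequality \<open>power_cap_bound\<close>.
\<close>

lemma measure_cap_unit_vector:
  fixes a :: "real ^ 'n" and t :: real
  assumes n: "CARD('n) \<ge> 2" and t: "1 / sqrt 2 < t" and a: "norm a = 1" and k: "t < a $ k"
  defines "V \<equiv> 2 ^ (CARD('n) - 1) / fact CARD('n) * (1 - t) ^ CARD('n)"
  shows "a $ k = 1 \<Longrightarrow> measure lebesgue (cross_polytope \<inter> {x. t \<le> x \<bullet> a}) = V"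
    and "a $ k < 1 \<Longrightarrow> measure lebesgue (cross_polytope \<inter> {x. t \<le> x \<bullet> a}) < V"
proof -
  let ?n = "CARD('n)" and ?A = "UNIV - {k}" and ?u = "a $ k"
  note t' = one_less_twice_square[OF t]
  note sum = unit_vector_square_sum[OF a, of k]
  have u: "0 < ?u" using t' k by simp
  have "t\<^sup>2 < ?u\<^sup>2"
    using t' k by (intro power_strict_mono) auto
  then have u2: "1 < 2 * ?u\<^sup>2" using t' by simp
  have aj: "(a $ j)\<^sup>2 \<le> 1 - ?u\<^sup>2" if "j \<noteq> k" for j
    unfolding sum[symmetric] using that by (intro member_le_sum) auto
  have small: "\<bar>a $ j\<bar> \<le> t" if "j \<noteq> k" for j
  proof -
    have "(a $ j)\<^sup>2 \<le> t\<^sup>2" using aj[OF that] u2 t' by simp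
    then show ?thesis using t' by (simp flip: abs_le_square_iff)
  qed
  have vol: "measure lebesgue (cross_polytope \<inter> {x. t \<le> x \<bullet> a}) =
      (?u - t) ^ ?n / (fact ?n * ?u) * (\<Prod>j\<in>?A. 2 * ?u / (?u\<^sup>2 - (a $ j)\<^sup>2))"
    by (rule measure_cross_polytope_cap[OF _ k small]) (use t' in auto)
  {
    assume u1: "?u = 1"
    have "a $ j = 0" if "j \<noteq> k" for j
      using aj[OF that] u1 by simp
    then have "(\<Prod>j\<in>?A. 2 * ?u / (?u\<^sup>2 - (a $ j)\<^sup>2)) = (\<Prod>j\<in>?A. 2)"
      using u1 by (intro prod.cong) auto
    then show "measure lebesgue (cross_polytope \<inter> {x. t \<le> x \<bullet> a}) = V"
      using u1 by (simp add: vol V_def)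
  }
  assume u1: "?u < 1"
  obtain m where m: "?n = Suc (Suc m)"
    using n by (metis add_2_eq_Suc le_Suc_ex)
  (* The product inequality is applied to the ratios of the squares, whose sum is at most 1
     because 2 * u^2 > 1. *)
  have D: "?u ^ (2 * m) * (2 * ?u\<^sup>2 - 1) \<le> (\<Prod>j\<in>?A. ?u\<^sup>2 - (a $ j)\<^sup>2)"
  proof -
    have ratio: "(\<Sum>j\<in>?A. (a $ j)\<^sup>2 / ?u\<^sup>2) = (1 - ?u\<^sup>2) / ?u\<^sup>2"
      by (simp add: sum flip: sum_divide_distrib)
    have "1 - (\<Sum>j\<in>?A. (a $ j)\<^sup>2 / ?u\<^sup>2) \<le> (\<Prod>j\<in>?A. 1 - (a $ j)\<^sup>2 / ?u\<^sup>2)"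
      using u u2 by (intro prod_one_minus_ge) (auto simp: ratio field_simps)
    then have "?u\<^sup>2 ^ Suc m * (1 - (1 - ?u\<^sup>2) / ?u\<^sup>2) \<le> ?u\<^sup>2 ^ Suc m * (\<Prod>j\<in>?A. 1 - (a $ j)\<^sup>2 / ?u\<^sup>2)"
      unfolding ratio by (intro mult_left_mono) auto
    also have "\<dots> = (\<Prod>j\<in>?A. ?u\<^sup>2 * (1 - (a $ j)\<^sup>2 / ?u\<^sup>2))"
      by (simp only: prod.distrib prod_constant) (simp add: m)
    also have "\<dots> = (\<Prod>j\<in>?A. ?u\<^sup>2 - (a $ j)\<^sup>2)"
      using u by (intro prod.cong) (auto simp: field_simps)
    also have "1 - (1 - ?u\<^sup>2) / ?u\<^sup>2 = (2 * ?u\<^sup>2 - 1) / ?u\<^sup>2"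
      using u by (simp add: field_simps)
    also have "?u\<^sup>2 ^ Suc m * ((2 * ?u\<^sup>2 - 1) / ?u\<^sup>2) = ?u ^ (2 * m) * (2 * ?u\<^sup>2 - 1)"
      using u by (simp add: power_mult)
    finally show ?thesis .
  qed
  define d where "d = ?u ^ (2 * m) * (2 * ?u\<^sup>2 - 1)"
  have d: "0 < d" using u u2 by (simp add: d_def)
  have "(\<Prod>j\<in>?A. 2 * ?u / (?u\<^sup>2 - (a $ j)\<^sup>2)) = (2 * ?u) ^ Suc m / (\<Prod>j\<in>?A. ?u\<^sup>2 - (a $ j)\<^sup>2)"
    by (simp only: prod_dividef prod_constant) (simp add: m)
  also have "\<dots> \<le> (2 * ?u) ^ Suc m / d"
    using D d u unfolding d_def[symmetric] by (intro divide_left_mono mult_pos_pos) auto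
  finally have "measure lebesgue (cross_polytope \<inter> {x. t \<le> x \<bullet> a})
      \<le> (?u - t) ^ ?n / (fact ?n * ?u) * ((2 * ?u) ^ Suc m / d)"
    unfolding vol using u k by (intro mult_left_mono divide_nonneg_nonneg) auto
  also have "\<dots> < (1 - t) ^ ?n * (?u ^ m * (2 * ?u\<^sup>2 - 1)) / (fact ?n * ?u) * ((2 * ?u) ^ Suc m / d)"
  proof -
    have "(?u - t) ^ ?n < (1 - t) ^ ?n * (?u ^ m * (2 * ?u\<^sup>2 - 1))"
      using power_cap_bound[OF t'(2,1) k u1 n] by (simp add: m)
    then show ?thesis
    proof (intro mult_strict_right_mono divide_strict_right_mono)
      show "0 < fact ?n * ?u" "0 < (2 * ?u) ^ Suc m / d"
        using u d by simp_all
    qed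
  qed
  also have "\<dots> = V"
  proof -
    have cancel: "P * (x * e) / (F * v) * (c * (v * x) / (x * x * e)) = c / F * P"
      if "x \<noteq> 0" "e \<noteq> 0" "v \<noteq> 0" for P x e F v c :: real
      using that by (simp add: divide_simps)
    have pow: "(2 * ?u) ^ Suc m = 2 ^ Suc m * (?u * ?u ^ m)"
      by (simp add: power_mult_distrib)
    have pow': "?u ^ (2 * m) = ?u ^ m * ?u ^ m"
      by (simp only: mult_2 power_add)
    have dim: "?n - 1 = Suc m"
      using m by simp
    show ?thesis
      unfolding V_def d_def dim pow pow'
    proof (rule cancel)
      show "?u ^ m \<noteq> 0" "2 * ?u\<^sup>2 - 1 \<noteq> 0" "?u \<noteq> 0"
        using u u2 by simp_all
    qed
  qed
  finally show "measure lebesgue (cross_polytope \<inter> {x. t \<le> x \<bullet> a}) < V" .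
qed

section \<open>From caps to the slab\<close>

text \<open>
  The two caps are reflections of each other, and the three parts of the cross-polytope meet only in
  the two bounding hyperplanes.
\<close>

lemma measure_cross_polytope_slab:
  fixes a :: "real ^ 'n" and t :: real
  assumes t: "0 < t" and a: "a \<noteq> 0"
  shows "measure lebesgue (cross_polytope \<inter> symmetric_slab a t) =
    2 ^ CARD('n) / fact CARD('n) - 2 * measure lebesgue (cross_polytope \<inter> {x. t \<le> x \<bullet> a})"
proof -
  let ?B = "cross_polytope :: (real ^ 'n) set"
  let ?S = "?B \<inter> symmetric_slab a t" and ?U = "?B \<inter> {x. t \<le> x \<bullet> a}" and ?L = "?B \<inter> {x. x \<bullet> a \<le> - t}"
  have closed: "closed (symmetric_slab a t)" "closed {x. t \<le> x \<bullet> a}" "closed {x. x \<bullet> a \<le> - t}"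
    unfolding symmetric_slab_def by (intro closed_Collect_le continuous_intros)+
  have hyperplane: "negligible {x. x \<bullet> a = c}" for c
    using negligible_hyperplane[of a c] a by (simp add: inner_commute)
  have "measure lebesgue ?B = measure lebesgue ?S + measure lebesgue ?U + measure lebesgue ?L"
  proof (rule measure_Un3_negligible)
    show "?S \<in> lmeasurable" "?U \<in> lmeasurable" "?L \<in> lmeasurable"
      by (intro lmeasurable_compact compact_Int_closed compact_cross_polytope closed)+
    show "negligible (?S \<inter> ?U)"
      by (rule negligible_subset[OF hyperplane[of t]]) (auto simp: symmetric_slab_def)
    show "negligible (?S \<inter> ?L)"
      by (rule negligible_subset[OF hyperplane[of "- t"]]) (auto simp: symmetric_slab_def)
    have "?U \<inter> ?L = {}"
      using t by auto
    then show "negligible (?U \<inter> ?L)"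
      by simp
    show "?S \<union> ?U \<union> ?L = ?B"
      by (auto simp: symmetric_slab_def)
  qed
  moreover have "measure lebesgue ?L = measure lebesgue ?U"
  proof -
    have "?L = (\<lambda>x. (- 1) *\<^sub>R x + 0) ` ?U"
    proof (intro equalityI subsetI)
      fix x assume "x \<in> ?L"
      then show "x \<in> (\<lambda>x. (- 1) *\<^sub>R x + 0) ` ?U"
        by (intro image_eqI[of _ _ "- x"]) (auto simp: cross_polytope_def)
    qed (auto simp: cross_polytope_def)
    then show ?thesis
      using measure_lebesgue_affine[of "- 1" 0 ?U] by simp
  qed
  ultimately show ?thesis
    by (simp add: measure_cross_polytope)
qed

lemma cross_polytope_subset_slab:
  fixes a :: "real ^ 'n" and t :: real
  assumes t: "\<And>k. \<bar>a $ k\<bar> \<le> t"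
  shows "cross_polytope \<subseteq> symmetric_slab a t"
proof
  fix x :: "real ^ 'n" assume x: "x \<in> cross_polytope"
  have t0: "0 \<le> t" using t[of undefined] by simp
  have "\<bar>x \<bullet> a\<bar> \<le> (\<Sum>i\<in>UNIV. \<bar>x $ i\<bar> * \<bar>a $ i\<bar>)"
    unfolding inner_vec_def by (rule order_trans[OF sum_abs]) (simp add: abs_mult)
  also have "\<dots> \<le> (\<Sum>i\<in>UNIV. \<bar>x $ i\<bar> * t)"
    by (intro sum_mono mult_left_mono t) auto
  also have "\<dots> \<le> 1 * t"
    using x t0 unfolding sum_distrib_right[symmetric] cross_polytope_def
    by (intro mult_right_mono) auto
  finally show "x \<in> symmetric_slab a t"
    by (simp add: symmetric_slab_def)
qed

lemma along_coordinate_axis_unit_vector: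
  fixes a :: "real ^ 'n"
  assumes a: "norm a = 1"
  shows "along_coordinate_axis a \<longleftrightarrow> (\<exists>k. \<bar>a $ k\<bar> = 1)"
proof
  assume "along_coordinate_axis a"
  then obtain i c where c: "a = c *\<^sub>R axis i 1"
    by (auto simp: along_coordinate_axis_def)
  with a have "\<bar>a $ i\<bar> = 1" by (simp add: norm_axis_1)
  then show "\<exists>k. \<bar>a $ k\<bar> = 1" ..
next
  assume "\<exists>k. \<bar>a $ k\<bar> = 1"
  then obtain k where "\<bar>a $ k\<bar> = 1" ..
  then have "(a $ k)\<^sup>2 = 1" by (metis power2_abs one_power2)
  then have "\<forall>j\<in>UNIV - {k}. (a $ j)\<^sup>2 = 0"
    using unit_vector_square_sum[OF a, of k] by (subst sum_nonneg_eq_0_iff[symmetric]) auto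
  then have "a = a $ k *\<^sub>R axis k 1"
    by (auto simp: vec_eq_iff axis_def)
  then show "along_coordinate_axis a"
    unfolding along_coordinate_axis_def by blast
qed

text \<open>
  The case where the slab does not contain every vertex. Replacing \<open>a\<close> by \<open>- a\<close> leaves the slab unchanged, so the
  long coordinate may be taken positive.
\<close>

lemma slab_volume_long_coordinate:
  fixes a :: "real ^ 'n" and t :: real
  assumes n: "CARD('n) \<ge> 2" and t: "1 / sqrt 2 < t" and a: "norm a = 1" and k: "t < \<bar>a $ k\<bar>"
  defines "R \<equiv> 2 ^ CARD('n) / fact CARD('n) * (1 - (1 - t) ^ CARD('n))"
  shows "\<bar>a $ k\<bar> = 1 \<Longrightarrow> measure lebesgue (cross_polytope \<inter> symmetric_slab a t) = R"
    and "\<bar>a $ k\<bar> < 1 \<Longrightarrow> R < measure lebesgue (cross_polytope \<inter> symmetric_slab a t)"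
proof -
  define b where "b = (if 0 < a $ k then a else - a)"
  have b: "norm b = 1" and bk: "b $ k = \<bar>a $ k\<bar>"
    and slab: "symmetric_slab a t = symmetric_slab b t"
    using a by (auto simp: b_def symmetric_slab_def)
  define V where "V = 2 ^ (CARD('n) - 1) / fact CARD('n) * (1 - t) ^ CARD('n)"
  have "(2 :: real) ^ CARD('n) = 2 * 2 ^ (CARD('n) - 1)"
    by (simp flip: power_Suc)
  then have R: "R = 2 ^ CARD('n) / fact CARD('n) - 2 * V"
    unfolding R_def V_def by (simp only: right_diff_distrib)
  have "b \<noteq> 0" using b by auto
  then have vol: "measure lebesgue (cross_polytope \<inter> symmetric_slab a t) =
      2 ^ CARD('n) / fact CARD('n) - 2 * measure lebesgue (cross_polytope \<inter> {x. t \<le> x \<bullet> b})"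
    unfolding slab by (rule measure_cross_polytope_slab[OF one_less_twice_square(1)[OF t]])
  have tb: "t < b $ k" using k by (simp add: bk)
  note cap = measure_cap_unit_vector[OF n t b tb, folded V_def]
  show "\<bar>a $ k\<bar> = 1 \<Longrightarrow> measure lebesgue (cross_polytope \<inter> symmetric_slab a t) = R"
    using cap(1) by (simp add: vol R bk)
  show "\<bar>a $ k\<bar> < 1 \<Longrightarrow> R < measure lebesgue (cross_polytope \<inter> symmetric_slab a t)"
    using cap(2) by (simp add: vol R bk)
qed

theorem theorem5:
  fixes a :: "real ^ 'n" and t :: real
  assumes "CARD('n) \<ge> 3"
    and "1 / sqrt 2 < t" and "t \<le> 1"
    and "norm a = 1"
  shows "measure lebesgue (cross_polytope \<inter> symmetric_slab a t)
           \<ge> 2 ^ CARD('n) / fact CARD('n) * (1 - (1 - t) ^ CARD('n))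
       \<and> (measure lebesgue (cross_polytope \<inter> symmetric_slab a t)
             = 2 ^ CARD('n) / fact CARD('n) * (1 - (1 - t) ^ CARD('n))
           \<longleftrightarrow> along_coordinate_axis a \<or> t = 1)"
proof -
  note axis = along_coordinate_axis_unit_vector[OF assms(4)]
  have le1: "\<bar>a $ j\<bar> \<le> 1" for j
    using component_le_norm_cart[of a j] assms(4) by simp
  show ?thesis
  proof (cases "\<exists>k. t < \<bar>a $ k\<bar>")
    case False
    (* No vertex is cut off, so equality means (1 - t)^n = 0. An axis direction has a coordinate of
       absolute value 1 and falls into this case only for t = 1. *)
    then have small: "\<bar>a $ k\<bar> \<le> t" for k
      by (simp add: not_less)
    have "cross_polytope \<inter> symmetric_slab a t = cross_polytope"
      using cross_polytope_subset_slab[OF small] by blast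
    moreover have "along_coordinate_axis a \<Longrightarrow> t = 1"
    proof -
      assume "along_coordinate_axis a"
      then obtain k where "\<bar>a $ k\<bar> = 1"
        unfolding axis by blast
      then show "t = 1"
        using small[of k] assms(3) by simp
    qed
    moreover have "0 \<le> (1 - t) ^ CARD('n)" "(1 - t) ^ CARD('n) = 0 \<longleftrightarrow> t = 1"
      using assms(3) by auto
    ultimately show ?thesis
      by (auto simp: measure_cross_polytope right_diff_distrib)
  next
    case True
    then obtain k where k: "t < \<bar>a $ k\<bar>" ..
    have n: "CARD('n) \<ge> 2" using assms(1) by simp
    note slab = slab_volume_long_coordinate[OF n assms(2,4) k]
    have "t \<noteq> 1" using k le1[of k] by simp
    moreover have "along_coordinate_axis a \<longleftrightarrow> \<bar>a $ k\<bar> = 1"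
    proof
      assume "along_coordinate_axis a"
      then obtain i where i: "\<bar>a $ i\<bar> = 1" using axis by blast
      have "i = k"
      proof (rule ccontr)
        assume "i \<noteq> k"
        then have "(a $ k)\<^sup>2 \<le> (\<Sum>j\<in>UNIV - {i}. (a $ j)\<^sup>2)"
          by (intro member_le_sum) auto
        also have "\<dots> = 0"
          using unit_vector_square_sum[OF assms(4), of i] i by (simp add: abs_square_eq_1)
        finally show False
          using k one_less_twice_square(1)[OF assms(2)] by simp
      qed
      with i show "\<bar>a $ k\<bar> = 1" by simp
    next
      assume "\<bar>a $ k\<bar> = 1"
      then show "along_coordinate_axis a"
        unfolding axis ..
    qed
    moreover have "\<bar>a $ k\<bar> = 1 \<or> \<bar>a $ k\<bar> < 1"
      using le1[of k] by (simp add: le_less disj_commute)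
    ultimately show ?thesis
      using slab by (elim disjE) (simp_all add: less_imp_le)
  qed
qed

end
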